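(* Let $(\mathcal{R},\partial,\int)$ be an integro-differential ring with constants $\mathcal{C}$ and let $L=\partial+a\in\mathcal{R}\langle\partial,\int,\mathrm{E}\rangle$ with $a\in\mathcal{R}$. Assume that $z\in\mathcal{R}$ is such that $\partial z+az=0$ and that, in addition to a multiplicative right inverse $z^{-1}\in\mathcal{R}$ of $z$, also a right inverse $(\mathrm{E}z)^{-1}\in\mathcal{C}$ of $\mathrm{E}z$ exists. Then, in $\mathcal{R}\langle\partial,\int,\mathrm{E}\rangle$, the operator $$\textstyle G:=\bigl(1-z(\mathrm{E}z)^{-1}\cdot\mathrm{E}\bigr)\cdot z\cdot\int\cdot z^{-1}$$ satisfies $L\cdot G=1$ and $\mathrm{E}\cdot G=0$.
   Context: Rings are unital, nonzero, not necessarily commutative, of arbitrary characteristic. A derivation on a ring $\mathcal{R}$ is an additive map $\partial$ with $\partial(fg)=(\partial f)g+f\,\partial g$; $\mathcal{C}=\{f\in\mathcal{R}:\partial f=0\}$ is the ring of constants. "$\mathcal{C}$-linear" means homomorphism of $\mathcal{C}$-bimodules. An integro-differential ring $(\mathcal{R},\partial,\int)$ is a differential ring together with a $\mathcal{C}$-linear map $\int\colon\mathcal{R}\to\mathcal{R}$ satisfying $\partial\int f=f$ for all $f$. Its induced evaluation is $\mathrm{E}f:=f-\int\partial f\in\mathcal{C}$. The ring of integro-differential operators $\mathcal{R}\langle\partial,\int,\mathrm{E}\rangle$ is the (noncommutative unital) ring extension of $\mathcal{R}$ generated by indeterminates $\partial,\int,\mathrm{E}$ that commute with all elements of $\mathcal{C}$,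 subject to the identities, for all $f\in\mathcal{R}$: $\partial\cdot f=f\cdot\partial+\partial f$, $\ \partial\cdot\int=1$, $\ \int\cdot\partial=1-\mathrm{E}$, $\ \partial\cdot f\cdot\mathrm{E}=\partial f\cdot\mathrm{E}$, $\ \int\cdot f\cdot\mathrm{E}=\int f\cdot\mathrm{E}$, $\ \mathrm{E}\cdot f\cdot\mathrm{E}=\mathrm{E}f\cdot\mathrm{E}$. Here the dot denotes multiplication of operators, whereas $\partial f,\int f,\mathrm{E}f$ without dot denote elements of $\mathcal{R}$. *)

theory Defs
  imports "HOL-Algebra.QuotRing" "HOL-Algebra.Free_Abelian_Groups"
begin

section \<open>Integro-differential rings\<close>

definition constants :: "('a, 'm) ring_scheme \<Rightarrow> ('a \<Rightarrow> 'a) \<Rightarrow> 'a set"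
  where "constants R d = {f \<in> carrier R. d f = \<zero>\<^bsub>R\<^esub>}"

locale differential_ring = ring R for R (structure) +
  fixes d :: "'a \<Rightarrow> 'a"
  assumes one_neq_zero: "\<one> \<noteq> \<zero>"
    and d_closed: "f \<in> carrier R \<Longrightarrow> d f \<in> carrier R"
    and d_add: "\<lbrakk>f \<in> carrier R; g \<in> carrier R\<rbrakk> \<Longrightarrow> d (f \<oplus> g) = d f \<oplus> d g"
    and d_mult: "\<lbrakk>f \<in> carrier R; g \<in> carrier R\<rbrakk> \<Longrightarrow> d (f \<otimes> g) = d f \<otimes> g \<oplus> f \<otimes> d g"

text \<open>The integral is required to be a homomorphism of bimodules over the constants.\<close>

locale integro_differential_ring = differential_ring +
  fixes integ :: "'a \<Rightarrow> 'a"
  assumes integ_closed: "f \<in> carrier R \<Longrightarrow> integ f \<in> carrier R"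
    and integ_add:
      "\<lbrakk>f \<in> carrier R; g \<in> carrier R\<rbrakk> \<Longrightarrow> integ (f \<oplus> g) = integ f \<oplus> integ g"
    and integ_lmult:
      "\<lbrakk>c \<in> constants R d; f \<in> carrier R\<rbrakk> \<Longrightarrow> integ (c \<otimes> f) = c \<otimes> integ f"
    and integ_rmult:
      "\<lbrakk>c \<in> constants R d; f \<in> carrier R\<rbrakk> \<Longrightarrow> integ (f \<otimes> c) = integ f \<otimes> c"
    and d_integ: "f \<in> carrier R \<Longrightarrow> d (integ f) = f"

definition evaluation :: "('a, 'm) ring_scheme \<Rightarrow> ('a \<Rightarrow> 'a) \<Rightarrow> ('a \<Rightarrow> 'a) \<Rightarrow> 'a \<Rightarrow> 'a"
  where "evaluation R d integ f = f \<ominus>\<^bsub>R\<^esub> integ (d f)"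


section \<open>Free noncommutative rings\<close>

text \<open>
  The free ring on a set is the integral monoid ring of the free monoid of words over it. Words
  are wrapped in a type of their own, since the multiplication of \<^typ>\<open>'b \<Rightarrow>\<^sub>0 int\<close> is the
  convolution with respect to the additive monoid structure of \<^typ>\<open>'b\<close>.
\<close>

datatype 'x word = Word (letters: "'x list")

instantiation word :: (type) monoid_add
begin

definition "0 = Word []"

definition "v + w = Word (letters v @ letters w)"

instance
  by standard (simp_all add: zero_word_def plus_word_def)

end

definition free_ring :: "'x set \<Rightarrow> ('x word \<Rightarrow>\<^sub>0 int) ring"
  where "free_ring X =
    \<lparr>carrier = {p. \<forall>w \<in> Poly_Mapping.keys p. set (letters w) \<subseteq> X},
     monoid.mult = (*), one = 1, ring.zero = 0, add = (+)\<rparr>"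

definition free_gen :: "'x \<Rightarrow> 'x word \<Rightarrow>\<^sub>0 int"
  where "free_gen x = Poly_Mapping.single (Word [x]) 1"

lemma free_ring_simps:
  "p \<in> carrier (free_ring X) \<longleftrightarrow> (\<forall>w \<in> Poly_Mapping.keys p. set (letters w) \<subseteq> X)"
  "p \<otimes>\<^bsub>free_ring X\<^esub> q = p * q" "p \<oplus>\<^bsub>free_ring X\<^esub> q = p + q"
  "\<one>\<^bsub>free_ring X\<^esub> = 1" "\<zero>\<^bsub>free_ring X\<^esub> = 0"
  by (simp_all add: free_ring_def)

lemma free_ring_closed:
  assumes "p \<in> carrier (free_ring X)" "q \<in> carrier (free_ring X)"
  shows "p + q \<in> carrier (free_ring X)" "p - q \<in> carrier (free_ring X)"
    "p * q \<in> carrier (free_ring X)"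
proof -
  show "p + q \<in> carrier (free_ring X)"
    using assms keys_add[of p q] by (fastforce simp: free_ring_simps)
  show "p - q \<in> carrier (free_ring X)"
    using assms keys_diff[of p q] by (fastforce simp: free_ring_simps)
  show "p * q \<in> carrier (free_ring X)"
    unfolding free_ring_simps
  proof
    fix w assume "w \<in> Poly_Mapping.keys (p * q)"
    then obtain u v where "u \<in> Poly_Mapping.keys p" "v \<in> Poly_Mapping.keys q" "w = u + v"
      using keys_mult[of p q] by blast
    with assms show "set (letters w) \<subseteq> X"
      by (auto simp: free_ring_simps plus_word_def)
  qed
qed

lemma free_ring_uminus_closed: "p \<in> carrier (free_ring X) \<Longrightarrow> - p \<in> carrier (free_ring X)"
  by (simp add: free_ring_simps)

lemma free_ring_const_closed:
  "0 \<in> carrier (free_ring X)" "1 \<in> carrier (free_ring X)"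
  by (simp_all add: free_ring_simps zero_word_def)

lemma free_gen_closed: "x \<in> X \<Longrightarrow> free_gen x \<in> carrier (free_ring X)"
  by (simp add: free_ring_simps free_gen_def)

lemma ring_free_ring: "ring (free_ring X)"
proof (rule ringI)
  show "abelian_group (free_ring X)"
    by (rule abelian_groupI)
      (auto simp: free_ring_closed free_ring_uminus_closed free_ring_const_closed
        free_ring_simps(2-) add.assoc add.commute
        intro: bexI[of _ "- x" for x])
  show "Group.monoid (free_ring X)"
    by (rule monoidI)
      (auto simp: free_ring_closed free_ring_const_closed free_ring_simps(2-) mult.assoc)
qed (simp_all add: free_ring_simps(2-) algebra_simps)


lemma free_ring_minus:
  assumes "q \<in> carrier (free_ring X)"
  shows "\<ominus>\<^bsub>free_ring X\<^esub> q = - q" "p \<ominus>\<^bsub>free_ring X\<^esub> q = p - q"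
proof -
  interpret ring "free_ring X" by (rule ring_free_ring)
  show "\<ominus>\<^bsub>free_ring X\<^esub> q = - q"
    using assms by (intro minus_equality) (auto simp: free_ring_simps(2-) free_ring_uminus_closed)
  then show "p \<ominus>\<^bsub>free_ring X\<^esub> q = p - q"
    by (simp add: minus_eq free_ring_simps(2-))
qed


section \<open>The ring of integro-differential operators\<close>

datatype 'a ido_letter = Coeff 'a | Der | Integ | Eval

definition ido_letters :: "('a, 'm) ring_scheme \<Rightarrow> 'a ido_letter set"
  where "ido_letters R = Coeff ` carrier R \<union> {Der, Integ, Eval}"

text \<open>
  The first three rules make the coefficients a homomorphic image of \<open>R\<close>, the next three let the
  indeterminates commute with the constants.
\<close>

inductive ido_rel :: "('a, 'm) ring_scheme \<Rightarrow> ('a \<Rightarrow> 'a) \<Rightarrow> ('a \<Rightarrow> 'a) \<Rightarrow>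
    ('a ido_letter word \<Rightarrow>\<^sub>0 int) \<Rightarrow> ('a ido_letter word \<Rightarrow>\<^sub>0 int) \<Rightarrow> bool"
  for R :: "('a, 'm) ring_scheme" (structure) and d integ :: "'a \<Rightarrow> 'a"
where
  coeff_one: "ido_rel R d integ (free_gen (Coeff \<one>)) 1"
| coeff_add: "\<lbrakk>f \<in> carrier R; g \<in> carrier R\<rbrakk> \<Longrightarrow>
    ido_rel R d integ (free_gen (Coeff (f \<oplus> g))) (free_gen (Coeff f) + free_gen (Coeff g))"
| coeff_mult: "\<lbrakk>f \<in> carrier R; g \<in> carrier R\<rbrakk> \<Longrightarrow>
    ido_rel R d integ (free_gen (Coeff (f \<otimes> g))) (free_gen (Coeff f) * free_gen (Coeff g))"
| der_const: "c \<in> constants R d \<Longrightarrow>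
    ido_rel R d integ (free_gen Der * free_gen (Coeff c)) (free_gen (Coeff c) * free_gen Der)"
| integ_const: "c \<in> constants R d \<Longrightarrow>
    ido_rel R d integ (free_gen Integ * free_gen (Coeff c)) (free_gen (Coeff c) * free_gen Integ)"
| eval_const: "c \<in> constants R d \<Longrightarrow>
    ido_rel R d integ (free_gen Eval * free_gen (Coeff c)) (free_gen (Coeff c) * free_gen Eval)"
| der_coeff: "f \<in> carrier R \<Longrightarrow>
    ido_rel R d integ (free_gen Der * free_gen (Coeff f))
      (free_gen (Coeff f) * free_gen Der + free_gen (Coeff (d f)))"
| der_integ: "ido_rel R d integ (free_gen Der * free_gen Integ) 1"
| integ_der: "ido_rel R d integ (free_gen Integ * free_gen Der) (1 - free_gen Eval)"
| der_coeff_eval: "f \<in> carrier R \<Longrightarrow>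
    ido_rel R d integ (free_gen Der * free_gen (Coeff f) * free_gen Eval)
      (free_gen (Coeff (d f)) * free_gen Eval)"
| integ_coeff_eval: "f \<in> carrier R \<Longrightarrow>
    ido_rel R d integ (free_gen Integ * free_gen (Coeff f) * free_gen Eval)
      (free_gen (Coeff (integ f)) * free_gen Eval)"
| eval_coeff_eval: "f \<in> carrier R \<Longrightarrow>
    ido_rel R d integ (free_gen Eval * free_gen (Coeff f) * free_gen Eval)
      (free_gen (Coeff (evaluation R d integ f)) * free_gen Eval)"

definition ido_ideal :: "('a, 'm) ring_scheme \<Rightarrow> ('a \<Rightarrow> 'a) \<Rightarrow> ('a \<Rightarrow> 'a) \<Rightarrow>
    ('a ido_letter word \<Rightarrow>\<^sub>0 int) set"
  where "ido_ideal R d integ =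
    Idl\<^bsub>free_ring (ido_letters R)\<^esub> {p - q | p q. ido_rel R d integ p q}"

definition ido_ring :: "('a, 'm) ring_scheme \<Rightarrow> ('a \<Rightarrow> 'a) \<Rightarrow> ('a \<Rightarrow> 'a) \<Rightarrow>
    ('a ido_letter word \<Rightarrow>\<^sub>0 int) set ring"
  where "ido_ring R d integ = free_ring (ido_letters R) Quot ido_ideal R d integ"

definition ido_gen :: "('a, 'm) ring_scheme \<Rightarrow> ('a \<Rightarrow> 'a) \<Rightarrow> ('a \<Rightarrow> 'a) \<Rightarrow> 'a ido_letter \<Rightarrow>
    ('a ido_letter word \<Rightarrow>\<^sub>0 int) set"
  where "ido_gen R d integ x = ido_ideal R d integ +>\<^bsub>free_ring (ido_letters R)\<^esub> free_gen x"

context integro_differential_ring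
begin

lemma zero_maps: "d \<zero> = \<zero>" "integ \<zero> = \<zero>"
proof -
  have "d \<zero> \<oplus> d \<zero> = d \<zero>" "integ \<zero> \<oplus> integ \<zero> = integ \<zero>"
    using d_add[of \<zero> \<zero>] integ_add[of \<zero> \<zero>] by simp_all
  then show "d \<zero> = \<zero>" "integ \<zero> = \<zero>"
    by (simp_all add: d_closed integ_closed add.r_cancel_one')
qed

lemma evaluation_const:
  assumes "f \<in> carrier R"
  shows "evaluation R d integ f \<in> constants R d"
proof -
  have neg: "d (\<ominus> g) = \<ominus> d g" if "g \<in> carrier R" for g
    using d_add[of "\<ominus> g" g] that by (simp add: zero_maps d_closed l_neg minus_equality)
  show ?thesis
    using assms
    by (simp add: constants_def evaluation_def minus_eq d_add neg d_closed integ_closed d_integ r_neg)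
qed

lemma free_gen_closed_ido [simp]:
  "f \<in> carrier R \<Longrightarrow> free_gen (Coeff f) \<in> carrier (free_ring (ido_letters R))"
  "c \<in> constants R d \<Longrightarrow> free_gen (Coeff c) \<in> carrier (free_ring (ido_letters R))"
  "free_gen Der \<in> carrier (free_ring (ido_letters R))"
  "free_gen Integ \<in> carrier (free_ring (ido_letters R))"
  "free_gen Eval \<in> carrier (free_ring (ido_letters R))"
  by (auto intro!: free_gen_closed simp: ido_letters_def constants_def)

lemma ido_rel_closed:
  assumes "ido_rel R d integ p q"
  shows "p \<in> carrier (free_ring (ido_letters R))" "q \<in> carrier (free_ring (ido_letters R))"
  using assms
  by (cases; simp add: free_ring_closed free_ring_const_closed d_closed integ_closed
      evaluation_def)+

lemma ido_rel_diff_closed: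
  "{p - q | p q. ido_rel R d integ p q} \<subseteq> carrier (free_ring (ido_letters R))"
  by (auto intro: free_ring_closed ido_rel_closed)

lemma ideal_ido_ideal: "ideal (ido_ideal R d integ) (free_ring (ido_letters R))"
  unfolding ido_ideal_def
  by (rule ring.genideal_ideal[OF ring_free_ring ido_rel_diff_closed])

lemma ring_ido_ring: "ring (ido_ring R d integ)"
  unfolding ido_ring_def by (rule ideal.quotient_is_ring[OF ideal_ido_ideal])

text \<open>
  The ring of operators is indeed an extension of \<open>R\<close>: letting the indeterminates act on \<open>R\<close> by
  \<open>d\<close>, \<open>integ\<close> and the evaluation respects all defining relations.
\<close>

primrec letter_act :: "'a ido_letter \<Rightarrow> 'a \<Rightarrow> 'a" where
  "letter_act (Coeff f) g = f \<otimes> g"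
| "letter_act Der g = d g"
| "letter_act Integ g = integ g"
| "letter_act Eval g = evaluation R d integ g"

definition word_act :: "'a ido_letter word \<Rightarrow> 'a \<Rightarrow> 'a"
  where "word_act w g = foldr letter_act (letters w) g"

lemma evaluation_closed: "f \<in> carrier R \<Longrightarrow> evaluation R d integ f \<in> carrier R"
  by (simp add: evaluation_def d_closed integ_closed)

lemma eq_minusI: "\<lbrakk>x \<in> carrier R; y \<in> carrier R; z \<in> carrier R; x \<oplus> y = z\<rbrakk> \<Longrightarrow> x = z \<ominus> y"
  by (auto simp: minus_eq a_assoc r_neg)

lemma map_diff:
  assumes "f \<in> carrier R" "g \<in> carrier R"
  shows "d (f \<ominus> g) = d f \<ominus> d g" "integ (f \<ominus> g) = integ f \<ominus> integ g"
proof -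
  have fg: "(f \<ominus> g) \<oplus> g = f"
    using assms by (simp add: minus_eq a_assoc l_neg)
  show "d (f \<ominus> g) = d f \<ominus> d g" "integ (f \<ominus> g) = integ f \<ominus> integ g"
    using assms d_add[of "f \<ominus> g" g] integ_add[of "f \<ominus> g" g]
    by (auto simp: fg d_closed integ_closed intro!: eq_minusI)
qed

lemma letter_act_closed:
  "\<lbrakk>x \<in> ido_letters R; g \<in> carrier R\<rbrakk> \<Longrightarrow> letter_act x g \<in> carrier R"
  by (auto simp: ido_letters_def d_closed integ_closed evaluation_closed)

lemma letter_act_diff:
  assumes "x \<in> ido_letters R" "g \<in> carrier R" "h \<in> carrier R"
  shows "letter_act x (g \<ominus> h) = letter_act x g \<ominus> letter_act x h"
proof -
  have "u \<ominus> v \<ominus> (u' \<ominus> v') = (u \<ominus> u') \<ominus> (v \<ominus> v')"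
    if "u \<in> carrier R" "v \<in> carrier R" "u' \<in> carrier R" "v' \<in> carrier R" for u v u' v'
    using that by algebra
  moreover have "f \<otimes> (g \<ominus> h) = f \<otimes> g \<ominus> f \<otimes> h" if "f \<in> carrier R" for f
    using that assms by algebra
  ultimately show ?thesis
    using assms
    by (auto simp: ido_letters_def map_diff evaluation_def d_closed integ_closed)
qed

lemma word_act_simps:
  "word_act 0 g = g" "word_act (Word [x]) g = letter_act x g"
  "word_act (v + w) g = word_act v (word_act w g)"
  by (simp_all add: word_act_def zero_word_def plus_word_def)

lemma word_act_closed:
  "\<lbrakk>set (letters w) \<subseteq> ido_letters R; g \<in> carrier R\<rbrakk> \<Longrightarrow> word_act w g \<in> carrier R"
proof (induction w)
  case (Word xs)
  then show ?case
    by (induction xs) (auto simp: word_act_def letter_act_closed)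
qed

lemma word_act_diff:
  "\<lbrakk>set (letters w) \<subseteq> ido_letters R; g \<in> carrier R; h \<in> carrier R\<rbrakk> \<Longrightarrow>
    word_act w (g \<ominus> h) = word_act w g \<ominus> word_act w h"
proof (induction w)
  case (Word xs)
  then show ?case
  proof (induction xs)
    case (Cons x xs)
    then show ?case
      using word_act_closed[of "Word xs"] by (simp add: word_act_def letter_act_diff)
  qed (simp add: word_act_def)
qed

lemma obtain_action:
  obtains act where
    "\<And>p g. \<lbrakk>p \<in> carrier (free_ring (ido_letters R)); g \<in> carrier R\<rbrakk> \<Longrightarrow> act p g \<in> carrier R"
    "\<And>x g. \<lbrakk>x \<in> ido_letters R; g \<in> carrier R\<rbrakk> \<Longrightarrow> act (free_gen x) g = letter_act x g"
    "\<And>g. g \<in> carrier R \<Longrightarrow> act 1 g = g"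
    "\<And>p q g. \<lbrakk>p \<in> carrier (free_ring (ido_letters R)); q \<in> carrier (free_ring (ido_letters R));
      g \<in> carrier R\<rbrakk> \<Longrightarrow> act (p + q) g = act p g \<oplus> act q g"
    "\<And>p q g. \<lbrakk>p \<in> carrier (free_ring (ido_letters R)); q \<in> carrier (free_ring (ido_letters R));
      g \<in> carrier R\<rbrakk> \<Longrightarrow> act (p - q) g = act p g \<ominus> act q g"
    "\<And>p q g. \<lbrakk>p \<in> carrier (free_ring (ido_letters R)); q \<in> carrier (free_ring (ido_letters R));
      g \<in> carrier R\<rbrakk> \<Longrightarrow> act (p * q) g = act p (act q g)"
    "\<And>p. p \<in> carrier (free_ring (ido_letters R)) \<Longrightarrow> act p \<zero> = \<zero>"
proof -
  define S where "S = {w. set (letters w) \<subseteq> ido_letters R}"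
  let ?F = "free_ring (ido_letters R)"
  have carr: "p \<in> carrier ?F \<longleftrightarrow> Poly_Mapping.keys p \<subseteq> S" for p
    by (auto simp: free_ring_simps S_def)
  have "\<exists>h. g \<in> carrier R \<longrightarrow> h \<in> hom (free_Abelian_group S) (add_monoid R) \<and>
      (\<forall>w \<in> S. h (frag_of w) = word_act w g)" for g
  proof (cases "g \<in> carrier R")
    case True
    then have "(\<lambda>w. word_act w g) ` S \<subseteq> carrier (add_monoid R)"
      by (auto simp: S_def word_act_closed)
    then obtain h where "h \<in> hom (free_Abelian_group S) (add_monoid R)"
        "\<And>w. w \<in> S \<Longrightarrow> h (frag_of w) = word_act w g"
      using comm_group.free_Abelian_group_universal[OF a_comm_group] by metis
    then show ?thesis
      by (intro exI[of _ h]) simp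
  qed simp
  then obtain h where h: "\<And>g. g \<in> carrier R \<Longrightarrow> h g \<in> hom (free_Abelian_group S) (add_monoid R)"
      "\<And>g w. \<lbrakk>g \<in> carrier R; w \<in> S\<rbrakk> \<Longrightarrow> h g (frag_of w) = word_act w g"
    by metis
  define act where "act p g = h g p" for p g
  have cl: "act p g \<in> carrier R" if "p \<in> carrier ?F" "g \<in> carrier R" for p g
    using that h(1)[of g] by (auto simp: carr act_def hom_def Pi_def)
  have add: "act (p + q) g = act p g \<oplus> act q g"
    if "p \<in> carrier ?F" "q \<in> carrier ?F" "g \<in> carrier R" for p q g
    using that h(1)[of g] by (auto simp: carr act_def hom_def)
  have diff: "act (p - q) g = act p g \<ominus> act q g"
    if "p \<in> carrier ?F" "q \<in> carrier ?F" "g \<in> carrier R" for p q g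
    using that add[of "p - q" q g] cl by (auto simp: free_ring_closed intro!: eq_minusI)
  have zero: "act 0 g = \<zero>" if "g \<in> carrier R" for g
    using diff[of 0 0 g] cl that by (simp add: free_ring_const_closed minus_eq r_neg)
  have word: "act (frag_of w) g = word_act w g" if "w \<in> S" "g \<in> carrier R" for w g
    using that h(2) by (simp add: act_def)
  have frag_closed: "frag_of w \<in> carrier ?F" if "w \<in> S" for w
    using that by (simp add: carr)
  have act_diff: "p \<in> carrier ?F \<and> (\<forall>f \<in> carrier R. \<forall>g \<in> carrier R.
      act p (f \<ominus> g) = act p f \<ominus> act p g)" if "p \<in> carrier ?F" for p
  proof -
    from that have "Poly_Mapping.keys p \<subseteq> S" by (simp add: carr)
    then show ?thesis
    proof (induction p rule: frag_induction)
      case (diff p q)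
      have "u \<ominus> v \<ominus> (u' \<ominus> v') = (u \<ominus> u') \<ominus> (v \<ominus> v')"
        if "u \<in> carrier R" "v \<in> carrier R" "u' \<in> carrier R" "v' \<in> carrier R" for u v u' v'
        using that by algebra
      with diff show ?case
        by (auto simp: \<open>\<And>p q g. _ \<Longrightarrow> _ \<Longrightarrow> _ \<Longrightarrow> act (p - q) g = _\<close> free_ring_closed cl)
    qed (auto simp: zero free_ring_const_closed minus_eq r_neg frag_closed word S_def
        word_act_diff[unfolded minus_eq])
  qed
  have act_zero: "act p \<zero> = \<zero>" if "p \<in> carrier ?F" for p
    using act_diff[OF that] cl[OF that, of \<zero>] by (metis minus_eq r_neg zero_closed)
  have mult1: "p \<in> carrier ?F \<and> (\<forall>g \<in> carrier R. act (frag_of v * p) g = word_act v (act p g))"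
    if "p \<in> carrier ?F" and v: "v \<in> S" for p v
  proof -
    from that have "Poly_Mapping.keys p \<subseteq> S" by (simp add: carr)
    then show ?thesis
    proof (induction p rule: frag_induction)
      case zero
      then show ?case
        using v by (simp add: \<open>\<And>g. _ \<Longrightarrow> act 0 g = \<zero>\<close> free_ring_const_closed frag_closed
            flip: word act_zero)
    next
      case (one w)
      then have "v + w \<in> S"
        using v by (auto simp: S_def plus_word_def)
      with one v show ?case
        by (simp add: frag_closed word mult_single word_act_simps)
    next
      case (diff p q)
      then show ?case
        using v by (auto simp: \<open>\<And>p q g. _ \<Longrightarrow> _ \<Longrightarrow> _ \<Longrightarrow> act (p - q) g = _\<close> free_ring_closed
            frag_closed right_diff_distrib cl S_def word_act_diff)
    qed
  qed
  have mult: "p \<in> carrier ?F \<and> (\<forall>g \<in> carrier R. act (p * q) g = act p (act q g))"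
    if "p \<in> carrier ?F" and q: "q \<in> carrier ?F" for p q
  proof -
    from that have "Poly_Mapping.keys p \<subseteq> S" by (simp add: carr)
    then show ?thesis
    proof (induction p rule: frag_induction)
      case zero
      then show ?case
        using q by (simp add: \<open>\<And>g. _ \<Longrightarrow> act 0 g = \<zero>\<close> free_ring_const_closed cl)
    next
      case (one w)
      then show ?case
        using q mult1[OF q one] by (simp add: frag_closed word cl)
    next
      case (diff p r)
      then show ?case
        using q by (auto simp: \<open>\<And>p q g. _ \<Longrightarrow> _ \<Longrightarrow> _ \<Longrightarrow> act (p - q) g = _\<close> free_ring_closed
            left_diff_distrib cl)
    qed
  qed
  show thesis
  proof (rule that[of act])
    show "act 1 g = g" if "g \<in> carrier R" for g
    proof -
      have "(0 :: 'a ido_letter word) \<in> S" by (simp add: S_def zero_word_def)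
      from word[OF this that] show ?thesis
        by (simp add: word_act_simps single_one)
    qed
    show "act (free_gen x) g = letter_act x g" if "x \<in> ido_letters R" "g \<in> carrier R" for x g
      using word[of "Word [x]" g] that
      by (simp add: S_def free_gen_def word_act_simps)
  qed (use cl add diff mult act_zero in auto)
qed

lemma inj_on_ido_coeff: "inj_on (\<lambda>f. ido_gen R d integ (Coeff f)) (carrier R)"
proof (rule inj_onI)
  fix f g
  assume fg: "f \<in> carrier R" "g \<in> carrier R"
    and eq: "ido_gen R d integ (Coeff f) = ido_gen R d integ (Coeff g)"
  let ?F = "free_ring (ido_letters R)"
  interpret F: ring ?F by (rule ring_free_ring)
  interpret I: ideal "ido_ideal R d integ" ?F by (rule ideal_ido_ideal)
  obtain act where act:
    "\<And>p g. \<lbrakk>p \<in> carrier ?F; g \<in> carrier R\<rbrakk> \<Longrightarrow> act p g \<in> carrier R"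
    "\<And>x g. \<lbrakk>x \<in> ido_letters R; g \<in> carrier R\<rbrakk> \<Longrightarrow> act (free_gen x) g = letter_act x g"
    "\<And>g. g \<in> carrier R \<Longrightarrow> act 1 g = g"
    "\<And>p q g. \<lbrakk>p \<in> carrier ?F; q \<in> carrier ?F; g \<in> carrier R\<rbrakk> \<Longrightarrow>
      act (p + q) g = act p g \<oplus> act q g"
    "\<And>p q g. \<lbrakk>p \<in> carrier ?F; q \<in> carrier ?F; g \<in> carrier R\<rbrakk> \<Longrightarrow>
      act (p - q) g = act p g \<ominus> act q g"
    "\<And>p q g. \<lbrakk>p \<in> carrier ?F; q \<in> carrier ?F; g \<in> carrier R\<rbrakk> \<Longrightarrow>
      act (p * q) g = act p (act q g)"
    "\<And>p. p \<in> carrier ?F \<Longrightarrow> act p \<zero> = \<zero>"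
    by (rule obtain_action) (rule that)
  define K where "K = {p \<in> carrier ?F. \<forall>g \<in> carrier R. act p g = \<zero>}"
  have zero: "act 0 g = \<zero>" if "g \<in> carrier R" for g
    using act(5)[of 0 0 g] act(1)[of 0 g] that
    by (simp add: free_ring_const_closed minus_eq r_neg)
  have "ideal K ?F"
  proof (rule idealI[OF ring_free_ring])
    show "subgroup K (add_monoid ?F)"
    proof (rule group.subgroupI[OF F.add.is_group])
      show "inv\<^bsub>add_monoid ?F\<^esub> p \<in> K" if "p \<in> K" for p
      proof -
        have "act (- p) g = \<zero>" if "g \<in> carrier R" for g
          using act(5)[of 0 p g] that \<open>p \<in> K\<close>
          by (simp add: K_def zero free_ring_const_closed minus_eq)
        then show ?thesis
          using that unfolding a_inv_def[symmetric]
          by (simp add: K_def free_ring_minus free_ring_uminus_closed)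
      qed
    qed (auto simp: K_def zero act free_ring_closed free_ring_const_closed free_ring_simps(2-)
        intro: exI[of _ 0])
  qed (auto simp: K_def act free_ring_closed free_ring_simps(2-))
  moreover have "{p - q | p q. ido_rel R d integ p q} \<subseteq> K"
  proof clarify
    fix p q assume rel: "ido_rel R d integ p q"
    have letter: "x \<in> {Der, Integ, Eval} \<Longrightarrow> x \<in> ido_letters R"
      "u \<in> carrier R \<Longrightarrow> Coeff u \<in> ido_letters R" for x u
      by (auto simp: ido_letters_def)
    have const: "c \<in> carrier R" "d c = \<zero>" if "c \<in> constants R d" for c
      using that by (simp_all add: constants_def)
    have ev: "d (evaluation R d integ u) = \<zero>" "evaluation R d integ u \<in> constants R d"
      if "u \<in> carrier R" for u
      using evaluation_const[OF that] by (auto simp: constants_def)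
    note closed = free_ring_closed free_ring_const_closed d_closed integ_closed evaluation_closed
    have "act p g = act q g" if g: "g \<in> carrier R" for g
      using rel
    proof cases
      case (eval_const c)
      with g show ?thesis
        by (simp add: act letter closed const d_mult integ_lmult evaluation_def minus_eq
            r_distr r_minus)
    next
      case (integ_der)
      have "integ (d g) = g \<ominus> (g \<ominus> integ (d g))"
        using g d_closed[OF g] integ_closed[OF d_closed[OF g]] by algebra
      with g integ_der show ?thesis
        by (simp add: act letter closed evaluation_def)
    next
      case (eval_coeff_eval f)
      with g ev[OF g] show ?thesis
        by (simp add: act letter closed)
          (simp add: evaluation_def[of R d integ "f \<otimes> _"] d_mult closed integ_rmult
            evaluation_def[of R d integ f] minus_eq l_distr l_minus)
    qed (use g ev[OF g] in \<open>simp_all add: act letter closed const d_mult integ_lmult integ_rmult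
        l_distr d_integ m_assoc a_comm\<close>)
    with rel show "p - q \<in> K"
      by (simp add: K_def act closed ido_rel_closed minus_eq r_neg)
  qed
  ultimately have "ido_ideal R d integ \<subseteq> K"
    unfolding ido_ideal_def by (rule F.genideal_minimal)
  moreover have "free_gen (Coeff f) - free_gen (Coeff g) \<in> ido_ideal R d integ"
    using eq fg F.quotient_eq_iff_same_a_r_cos[OF ideal_ido_ideal]
    by (simp add: ido_gen_def flip: free_ring_minus(2)[of _ "ido_letters R"])
  ultimately have "act (free_gen (Coeff f) - free_gen (Coeff g)) \<one> = \<zero>"
    by (auto simp: K_def)
  moreover have "Coeff f \<in> ido_letters R" "Coeff g \<in> ido_letters R"
    using fg by (auto simp: ido_letters_def)
  ultimately have "f \<ominus> g = \<zero>"
    using fg by (simp add: act(2,5))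
  with fg show "f = g"
    using minus_equality[of f "\<ominus> g"] by (simp add: minus_eq)
qed

lemma ido_coeff_ring_hom:
  "(\<lambda>f. ido_gen R d integ (Coeff f)) \<in> ring_hom R (ido_ring R d integ)"
proof (rule ring_hom_memI)
  let ?F = "free_ring (ido_letters R)"
  interpret F: ring ?F by (rule ring_free_ring)
  interpret I: ideal "ido_ideal R d integ" ?F by (rule ideal_ido_ideal)
  have eqI: "ido_ideal R d integ +>\<^bsub>?F\<^esub> p = ido_ideal R d integ +>\<^bsub>?F\<^esub> q"
    if "ido_rel R d integ p q" for p q
  proof -
    have "p - q \<in> ido_ideal R d integ"
      using that F.genideal_self[OF ido_rel_diff_closed] by (auto simp: ido_ideal_def)
    then show ?thesis
      using F.quotient_eq_iff_same_a_r_cos[OF ideal_ido_ideal ido_rel_closed[OF that]]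
      by (simp add: free_ring_minus(2) ido_rel_closed(2)[OF that])
  qed
  show "ido_gen R d integ (Coeff f) \<in> carrier (ido_ring R d integ)" if "f \<in> carrier R" for f
    using that by (auto simp: ido_gen_def ido_ring_def FactRing_def intro!: F.a_rcosetsI I.a_subset)
  show "ido_gen R d integ (Coeff \<one>) = \<one>\<^bsub>ido_ring R d integ\<^esub>"
    using eqI[OF coeff_one] by (simp add: ido_gen_def ido_ring_def FactRing_simps free_ring_simps(2-))
  show "ido_gen R d integ (Coeff (f \<otimes> g)) =
      ido_gen R d integ (Coeff f) \<otimes>\<^bsub>ido_ring R d integ\<^esub> ido_gen R d integ (Coeff g)"
    if "f \<in> carrier R" "g \<in> carrier R" for f g
    using that eqI[OF coeff_mult[OF that]]
    by (simp add: ido_gen_def ido_ring_def FactRing_simps I.rcoset_mult_add free_ring_simps(2-))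
  show "ido_gen R d integ (Coeff (f \<oplus> g)) =
      ido_gen R d integ (Coeff f) \<oplus>\<^bsub>ido_ring R d integ\<^esub> ido_gen R d integ (Coeff g)"
    if "f \<in> carrier R" "g \<in> carrier R" for f g
    using that eqI[OF coeff_add[OF that]]
    by (simp add: ido_gen_def ido_ring_def FactRing_simps I.a_rcos_sum free_ring_simps(2-))
qed

end

end

theory Submission
  imports Defs
begin

text \<open>
  Since \<open>z\<close> solves the homogeneous equation, \<open>L \<cdot> z = z \<cdot> \<partial>\<close>. With \<open>c = (E z)\<^sup>-\<^sup>1\<close> constant and
  \<open>\<partial> \<cdot> E = 0\<close>, this makes \<open>L\<close> annihilate the correction term \<open>z \<cdot> c \<cdot> E\<close>, so that
  \<open>L \<cdot> G = z \<cdot> \<partial> \<cdot> \<integral> \<cdot> z\<^sup>-\<^sup>1 = 1\<close>. The correction is chosen such that \<open>E \<cdot> z \<cdot> c \<cdot> E = E\<close>,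
  whence already \<open>E\<close> times the leftmost factor of \<open>G\<close> vanishes.
\<close>

context integro_differential_ring
begin

abbreviation "ido_class p \<equiv> ido_ideal R d integ +>\<^bsub>free_ring (ido_letters R)\<^esub> p"

lemma ido_class_ring_hom: "ido_class \<in> ring_hom (free_ring (ido_letters R)) (ido_ring R d integ)"
  unfolding ido_ring_def by (rule ideal.rcos_ring_hom[OF ideal_ido_ideal])

text \<open>The ideal is generated by the differences \<open>p - q\<close> of related pairs, so both
  sides of a defining relation lie in the same coset.\<close>

lemma ido_class_eqI:
  assumes "ido_rel R d integ p q"
  shows "ido_class p = ido_class q"
proof -
  interpret F: ring "free_ring (ido_letters R)" by (rule ring_free_ring)
  have "p - q \<in> ido_ideal R d integ"
    using assms F.genideal_self[OF ido_rel_diff_closed] by (auto simp: ido_ideal_def)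
  then show ?thesis
    using F.quotient_eq_iff_same_a_r_cos[OF ideal_ido_ideal ido_rel_closed[OF assms]]
    by (simp add: free_ring_minus(2) ido_rel_closed(2)[OF assms])
qed

lemma ido_gen_closed:
  "x \<in> ido_letters R \<Longrightarrow> ido_gen R d integ x \<in> carrier (ido_ring R d integ)"
  unfolding ido_gen_def by (rule ring_hom_closed[OF ido_class_ring_hom free_gen_closed])

lemma ido_class_simps:
  "\<lbrakk>p \<in> carrier (free_ring (ido_letters R)); q \<in> carrier (free_ring (ido_letters R))\<rbrakk> \<Longrightarrow>
    ido_class (p * q) = ido_class p \<otimes>\<^bsub>ido_ring R d integ\<^esub> ido_class q"
  "\<lbrakk>p \<in> carrier (free_ring (ido_letters R)); q \<in> carrier (free_ring (ido_letters R))\<rbrakk> \<Longrightarrow>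
    ido_class (p + q) = ido_class p \<oplus>\<^bsub>ido_ring R d integ\<^esub> ido_class q"
  "ido_class 1 = \<one>\<^bsub>ido_ring R d integ\<^esub>"
  using ring_hom_mult[OF ido_class_ring_hom, of p q] ring_hom_add[OF ido_class_ring_hom, of p q]
    ring_hom_one[OF ido_class_ring_hom]
  by (simp_all add: free_ring_simps(2-))

text \<open>The Leibniz rule for the product of \<open>\<one>\<close> with itself gives
  \<open>d \<one> = d \<one> \<oplus> d \<one>\<close>, and one summand cancels.\<close>

lemma d_one: "d \<one> = \<zero>"
  using d_mult[of \<one> \<one>] by (simp add: d_closed add.r_cancel_one')

text \<open>The coset map is a ring homomorphism, so each relation between words becomes an identity
  between the generators of the quotient. From here on, computations take place in the operator ring
  and no longer in the free ring.\<close>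

lemma ido_relations:
  fixes A coeff D J E
  defines "A \<equiv> ido_ring R d integ" and "coeff \<equiv> \<lambda>f. ido_gen R d integ (Coeff f)"
    and "D \<equiv> ido_gen R d integ Der" and "J \<equiv> ido_gen R d integ Integ"
    and "E \<equiv> ido_gen R d integ Eval"
  shows "f \<in> carrier R \<Longrightarrow> D \<otimes>\<^bsub>A\<^esub> coeff f = coeff f \<otimes>\<^bsub>A\<^esub> D \<oplus>\<^bsub>A\<^esub> coeff (d f)"
    and "D \<otimes>\<^bsub>A\<^esub> J = \<one>\<^bsub>A\<^esub>"
    and "c \<in> constants R d \<Longrightarrow> D \<otimes>\<^bsub>A\<^esub> coeff c = coeff c \<otimes>\<^bsub>A\<^esub> D"
    and "c \<in> constants R d \<Longrightarrow> E \<otimes>\<^bsub>A\<^esub> coeff c = coeff c \<otimes>\<^bsub>A\<^esub> E"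
    and "f \<in> carrier R \<Longrightarrow> D \<otimes>\<^bsub>A\<^esub> coeff f \<otimes>\<^bsub>A\<^esub> E = coeff (d f) \<otimes>\<^bsub>A\<^esub> E"
    and "f \<in> carrier R \<Longrightarrow>
      E \<otimes>\<^bsub>A\<^esub> coeff f \<otimes>\<^bsub>A\<^esub> E = coeff (evaluation R d integ f) \<otimes>\<^bsub>A\<^esub> E"
  using ido_class_eqI[OF der_coeff, of f] ido_class_eqI[OF der_integ]
    ido_class_eqI[OF der_const, of c] ido_class_eqI[OF eval_const, of c]
    ido_class_eqI[OF der_coeff_eval, of f] ido_class_eqI[OF eval_coeff_eval, of f]
  by (simp_all add: assms ido_gen_def ido_class_simps free_ring_closed d_closed
      evaluation_closed)

text \<open>This is not a defining relation itself, but the instance \<open>f = \<one>\<close> of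
  \<open>der_coeff_eval\<close>: the coefficient of \<open>\<one>\<close> is the unit of the
  operator ring, and that of \<open>d \<one> = \<zero>\<close> is its zero.\<close>

lemma ido_der_eval:
  "ido_gen R d integ Der \<otimes>\<^bsub>ido_ring R d integ\<^esub> ido_gen R d integ Eval = \<zero>\<^bsub>ido_ring R d integ\<^esub>"
proof -
  interpret A: ring "ido_ring R d integ" by (rule ring_ido_ring)
  have closed: "ido_gen R d integ Der \<in> carrier (ido_ring R d integ)"
    "ido_gen R d integ Eval \<in> carrier (ido_ring R d integ)"
    by (simp_all add: ido_gen_closed ido_letters_def)
  show ?thesis
    using ido_relations(5)[of \<one>] closed ring_hom_one[OF ido_coeff_ring_hom]
      ring_hom_zero[OF ido_coeff_ring_hom ring_axioms ring_ido_ring]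
    by (simp add: d_one)
qed

end

theorem theorem6p1:
  fixes R (structure) and d integ :: "'a \<Rightarrow> 'a" and a z zinv ezinv :: 'a
  assumes "integro_differential_ring R d integ"
    and "a \<in> carrier R" and "z \<in> carrier R"
    and "d z \<oplus> a \<otimes> z = \<zero>"
    and "zinv \<in> carrier R" and "z \<otimes> zinv = \<one>"
    and "ezinv \<in> constants R d" and "evaluation R d integ z \<otimes> ezinv = \<one>"
  shows "let A = ido_ring R d integ;
             coeff = (\<lambda>f. ido_gen R d integ (Coeff f));
             D = ido_gen R d integ Der;
             J = ido_gen R d integ Integ;
             E = ido_gen R d integ Eval;
             L = D \<oplus>\<^bsub>A\<^esub> coeff a;
             G = (\<one>\<^bsub>A\<^esub> \<ominus>\<^bsub>A\<^esub> coeff (z \<otimes> ezinv) \<otimes>\<^bsub>A\<^esub> E) \<otimes>\<^bsub>A\<^esub> coeff z \<otimes>\<^bsub>A\<^esub> J \<otimes>\<^bsub>A\<^esub> coeff zinv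
         in L \<otimes>\<^bsub>A\<^esub> G = \<one>\<^bsub>A\<^esub> \<and> E \<otimes>\<^bsub>A\<^esub> G = \<zero>\<^bsub>A\<^esub>"
proof -
  interpret R: integro_differential_ring R d integ by fact
  define A where "A = ido_ring R d integ"
  define coeff where "coeff = (\<lambda>f. ido_gen R d integ (Coeff f))"
  define D where "D = ido_gen R d integ Der"
  define J where "J = ido_gen R d integ Integ"
  define E where "E = ido_gen R d integ Eval"
  define L where "L = D \<oplus>\<^bsub>A\<^esub> coeff a"
  \<comment> \<open>The leftmost factor of \<open>G\<close>. Both claims reduce to
    \<open>L P = L\<close> and \<open>E P = 0\<close>.\<close>
  define P where "P = \<one>\<^bsub>A\<^esub> \<ominus>\<^bsub>A\<^esub> coeff (z \<otimes> ezinv) \<otimes>\<^bsub>A\<^esub> E"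
  interpret A: ring A unfolding A_def by (rule R.ring_ido_ring)
  have hom: "coeff \<in> ring_hom R A"
    unfolding coeff_def A_def by (rule R.ido_coeff_ring_hom)
  have coeff_apply: "coeff f = ido_gen R d integ (Coeff f)" for f
    by (simp add: coeff_def)
  note rel = R.ido_relations[folded A_def D_def J_def E_def coeff_apply]
  have c: "ezinv \<in> carrier R" using assms(7) by (simp add: constants_def)
  have coeff: "coeff f \<in> carrier A" if "f \<in> carrier R" for f
    using ring_hom_closed[OF hom that] .
  have gens: "D \<in> carrier A" "J \<in> carrier A" "E \<in> carrier A"
    by (simp_all add: D_def J_def E_def A_def R.ido_gen_closed ido_letters_def)
  note closed = gens coeff[OF assms(2)] coeff[OF assms(3)] coeff[OF assms(5)] coeff[OF c]
  have L: "L \<in> carrier A" and P: "P \<in> carrier A"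
    unfolding L_def P_def using assms c coeff gens by auto
  have zc: "coeff (z \<otimes> ezinv) = coeff z \<otimes>\<^bsub>A\<^esub> coeff ezinv"
    using ring_hom_mult[OF hom assms(3) c] .
  have DE: "D \<otimes>\<^bsub>A\<^esub> E = \<zero>\<^bsub>A\<^esub>"
    unfolding D_def E_def A_def by (rule R.ido_der_eval)
  \<comment> \<open>Moving \<open>D\<close> past \<open>coeff z\<close> leaves the extra coefficient
    \<open>d z\<close>, which cancels against \<open>a \<otimes> z\<close> by the homogeneous
    equation.\<close>
  have Lz: "L \<otimes>\<^bsub>A\<^esub> coeff z = coeff z \<otimes>\<^bsub>A\<^esub> D"
  proof -
    have "coeff (d z) \<oplus>\<^bsub>A\<^esub> coeff a \<otimes>\<^bsub>A\<^esub> coeff z = coeff (d z \<oplus> a \<otimes> z)"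
      using assms(2,3) by (simp add: ring_hom_add[OF hom] ring_hom_mult[OF hom] R.d_closed)
    also have "\<dots> = \<zero>\<^bsub>A\<^esub>"
      by (simp add: assms(4) ring_hom_zero[OF hom R.ring_axioms A.ring_axioms])
    finally have "coeff (d z) \<oplus>\<^bsub>A\<^esub> coeff a \<otimes>\<^bsub>A\<^esub> coeff z = \<zero>\<^bsub>A\<^esub>" .
    then show ?thesis
      using closed rel(1)[OF assms(3)] coeff[OF R.d_closed[OF assms(3)]]
      by (simp add: L_def A.l_distr A.a_assoc)
  qed
  have "L \<otimes>\<^bsub>A\<^esub> (coeff (z \<otimes> ezinv) \<otimes>\<^bsub>A\<^esub> E) = L \<otimes>\<^bsub>A\<^esub> coeff z \<otimes>\<^bsub>A\<^esub> coeff ezinv \<otimes>\<^bsub>A\<^esub> E"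
    using closed L by (simp add: zc A.m_assoc)
  also have "\<dots> = coeff z \<otimes>\<^bsub>A\<^esub> (D \<otimes>\<^bsub>A\<^esub> coeff ezinv) \<otimes>\<^bsub>A\<^esub> E"
    using closed by (simp add: Lz A.m_assoc)
  \<comment> \<open>\<open>D\<close> commutes with the constant \<open>ezinv\<close> and so meets
    \<open>E\<close>, where \<open>D E = 0\<close> applies.\<close>
  also have "\<dots> = \<zero>\<^bsub>A\<^esub>"
    using closed by (simp add: rel(3)[OF assms(7)] A.m_assoc DE)
  finally have LP: "L \<otimes>\<^bsub>A\<^esub> P = L"
    using closed L by (simp add: P_def zc A.minus_eq A.r_distr A.r_minus)
  have "E \<otimes>\<^bsub>A\<^esub> (coeff (z \<otimes> ezinv) \<otimes>\<^bsub>A\<^esub> E) = E \<otimes>\<^bsub>A\<^esub> coeff z \<otimes>\<^bsub>A\<^esub> (coeff ezinv \<otimes>\<^bsub>A\<^esub> E)"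
    using closed by (simp add: zc A.m_assoc)
  \<comment> \<open>Moving the constant \<open>ezinv\<close> to the right of \<open>E\<close>
    exposes the pattern \<open>E z E\<close> of \<open>eval_coeff_eval\<close>.\<close>
  also have "\<dots> = E \<otimes>\<^bsub>A\<^esub> coeff z \<otimes>\<^bsub>A\<^esub> E \<otimes>\<^bsub>A\<^esub> coeff ezinv"
    using closed by (simp add: A.m_assoc flip: rel(4)[OF assms(7)])
  \<comment> \<open>After \<open>E z E\<close> has collapsed, \<open>ezinv\<close> moves back to the
    left of \<open>E\<close>. It then stands directly to the right of the evaluation of
    \<open>z\<close>, the side on which it is an inverse.\<close>
  also have "\<dots> = coeff (evaluation R d integ z) \<otimes>\<^bsub>A\<^esub> coeff ezinv \<otimes>\<^bsub>A\<^esub> E"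
    using closed coeff[OF R.evaluation_closed[OF assms(3)]]
    by (simp add: rel(6)[OF assms(3)] A.m_assoc rel(4)[OF assms(7)])
  also have "coeff (evaluation R d integ z) \<otimes>\<^bsub>A\<^esub> coeff ezinv = \<one>\<^bsub>A\<^esub>"
    using ring_hom_mult[OF hom R.evaluation_closed[OF assms(3)] c] ring_hom_one[OF hom] assms(8)
    by simp
  finally have EP: "E \<otimes>\<^bsub>A\<^esub> P = \<zero>\<^bsub>A\<^esub>"
    using closed by (simp add: P_def zc A.minus_eq A.r_distr A.r_minus A.r_neg)
  have "L \<otimes>\<^bsub>A\<^esub> (P \<otimes>\<^bsub>A\<^esub> coeff z \<otimes>\<^bsub>A\<^esub> J \<otimes>\<^bsub>A\<^esub> coeff zinv)
      = L \<otimes>\<^bsub>A\<^esub> P \<otimes>\<^bsub>A\<^esub> coeff z \<otimes>\<^bsub>A\<^esub> J \<otimes>\<^bsub>A\<^esub> coeff zinv"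
    using closed L P by (simp add: A.m_assoc)
  \<comment> \<open>\<open>L P = L\<close> removes the correction, and \<open>L z = z D\<close>
    brings \<open>D\<close> next to \<open>J\<close>. Once \<open>D J = 1\<close> is used, only
    \<open>z \<otimes> zinv = \<one>\<close> remains.\<close>
  also have "\<dots> = coeff z \<otimes>\<^bsub>A\<^esub> (D \<otimes>\<^bsub>A\<^esub> J) \<otimes>\<^bsub>A\<^esub> coeff zinv"
    using closed by (simp add: LP Lz A.m_assoc)
  also have "\<dots> = \<one>\<^bsub>A\<^esub>"
    using closed ring_hom_one[OF hom]
    by (simp add: rel(2) assms(6) flip: ring_hom_mult[OF hom assms(3,5)])
  finally have LG: "L \<otimes>\<^bsub>A\<^esub> (P \<otimes>\<^bsub>A\<^esub> coeff z \<otimes>\<^bsub>A\<^esub> J \<otimes>\<^bsub>A\<^esub> coeff zinv) = \<one>\<^bsub>A\<^esub>" .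
  have "E \<otimes>\<^bsub>A\<^esub> (P \<otimes>\<^bsub>A\<^esub> coeff z \<otimes>\<^bsub>A\<^esub> J \<otimes>\<^bsub>A\<^esub> coeff zinv)
      = E \<otimes>\<^bsub>A\<^esub> P \<otimes>\<^bsub>A\<^esub> (coeff z \<otimes>\<^bsub>A\<^esub> J \<otimes>\<^bsub>A\<^esub> coeff zinv)"
    using closed P by (simp add: A.m_assoc)
  also have "\<dots> = \<zero>\<^bsub>A\<^esub>"
    using closed by (simp add: EP)
  finally show ?thesis
    using LG by (simp add: Let_def A_def coeff_def D_def J_def E_def L_def P_def)
qed

end
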